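(* Protocol-independent components refine the attacker: $$\Bigl(\big|\big|\big|_{i,\mathit{rid}}\bigl(\mathcal R^i_{\mathrm{role}}(\mathit{rid})\;|||\;\mathcal R_{\mathrm{ind}}(\mathit{rid})\bigr)\Bigr)\parallel_{\chi^+}\mathcal R^{e+}_{\mathrm{env}}\ \preccurlyeq\ \Bigl(\big|\big|\big|_{i,\mathit{rid}}\mathcal R^i_{\mathrm{role}}(\mathit{rid})\Bigr)\parallel_{\chi}\mathcal R^{e}_{\mathrm{env}},$$ i.e. every trace of the system on the left is a trace of the system on the right.
   Context: MSR systems. Fix a set $\Sigma$ of function symbols over terms (with types $\mathit{pub}$ of public constants and $\mathit{fresh}$ of fresh names). A multiset rewriting (MSR) system has rules $\ell\xrightarrow{a}r$, with $\ell,r$ multisets of facts and $a$ a label; fact symbols are linear or persistent. States are multisets of facts, initially empty. An instance of a rule applies in a state if $\ell$ is included in it; it removes the linear facts of $\ell$ (persistent facts are not consumed and their multiplicity is irrelevant), adds $r$, and emits the label $a$ (possibly the empty label $[\,]$, in which case it is omitted on the arrow). Rule guards are stable under enlarging the state. Traces are the label sequences of executions from the initial state, with empty labels disregarded (refinement by stuttering simulation); $\preccurlyeq$ is inclusion of trace sets. $|||$ is interleaving parallel composition (components have separate states). $X\parallel_\chi Y$ is synchronizing composition: for a partial function $\chi$ on pairs of labels, where a component may also contribute $\mathsf{skip}$ (not moving), the product makes a step labeled $\chi(e,e')$ whenever defined. Roles and environment. $i\in\{1,\dots,n\}$ ranges over protocol roles and $\mathit{rid}$ over run (thread) identifiers.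 $\mathcal R_{\mathrm{env}}$ is the environment: it contains the generation of fresh-name facts $\mathsf{Fr}(x)$ (each name generated at most once) and the attacker message deduction rules $\mathit{MD}_\Sigma$: $[\mathsf{out}(x)]\to[\mathsf K(x)]$; $[\mathsf K(x)]\xrightarrow{[\mathsf K(x)]}[\mathsf{in}(x)]$; $[]\to[\mathsf K(x\in\mathit{pub})]$; $[\mathsf{Fr}(x\in\mathit{fresh})]\to[\mathsf K(x)]$; $[\mathsf K(x_1),\dots,\mathsf K(x_k)]\to[\mathsf K(f(x_1,\dots,x_k))]$ for each $k$-ary $f\in\Sigma$. $\mathsf K$ is persistent; $\mathsf{in},\mathsf{out},\mathsf{Fr}$ are linear. $\mathcal R^i_{\mathrm{role}}(\mathit{rid})$ is the MSR system of run $\mathit{rid}$ of role $i$: the role's rules, over role-$i$ state facts and private buffered copies $F_i(\mathit{rid},\bar x)$ of input/output facts $F(\bar x)$, together with, for each output symbol $F$, the rule $[F_i(\mathit{rid},\bar x)]\xrightarrow{\lambda^s_{F,i,\mathit{rid}}(\bar x)}[]$ and, for each input symbol $F$, the rule $[]\xrightarrow{\lambda^s_{F,i,\mathit{rid}}(\bar x)}[F_i(\mathit{rid},\bar x)]$. $\mathcal R^e_{\mathrm{env}}$ consists of $\mathcal R_{\mathrm{env}}$ and the matching rules $[]\xrightarrow{\lambda^e_{F,i,\mathit{rid}}(\bar x)}[F(\bar x)]$ for output symbols and $[F(\bar x)]\xrightarrow{\lambda^e_{F,i,\mathit{rid}}(\bar x)}[]$ for input symbols. The partial function $\chi$ is: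 $\chi(\lambda^s_{F,i,\mathit{rid}}(\bar m),\lambda^e_{F,i,\mathit{rid}}(\bar m))=[\,]$; $\chi(e,\mathsf{skip})=e$ and $\chi(\mathsf{skip},e)=e$ for labels $e$ that are not synchronization labels; undefined otherwise. Protocol-independent components. $\mathsf{ind}$ (persistent) and $\mathsf{out_{ind}},\mathsf{in_{ind}}$ (linear) are reserved fact symbols not occurring in the rules above. $\mathcal R_{\mathrm{ind}}(\mathit{rid})$ has the rules $[\mathsf{ind}(\mathit{rid},x)]\xrightarrow{\lambda^s_{\mathsf{out_{ind}}}(\mathit{rid},x)}[]$; $[]\xrightarrow{\lambda^s_{\mathsf{in_{ind}}}(\mathit{rid},x)}[\mathsf{ind}(\mathit{rid},x)]$; $[]\to[\mathsf{ind}(\mathit{rid},x\in\mathit{pub})]$; $[]\xrightarrow{\lambda^s_{\mathsf{Fr_{ind}}}(\mathit{rid},x)}[\mathsf{ind}(\mathit{rid},x)]$; $[\mathsf{ind}(\mathit{rid},x_1),\dots,\mathsf{ind}(\mathit{rid},x_k)]\to[\mathsf{ind}(\mathit{rid},f(x_1,\dots,x_k))]$ for each $k$-ary $f\in\Sigma$. $\mathcal R^{e+}_{\mathrm{env}}$ is $\mathcal R^e_{\mathrm{env}}$ together with $[]\xrightarrow{\lambda^e_{\mathsf{out_{ind}}}(\mathit{rid},x)}[\mathsf{out_{ind}}(x)]$; $[\mathsf{in_{ind}}(x)]\xrightarrow{\lambda^e_{\mathsf{in_{ind}}}(\mathit{rid},x)}[]$; $[\mathsf{Fr}(x\in\mathit{fresh})]\xrightarrow{\lambda^e_{\mathsf{Fr_{ind}}}(\mathit{rid},x)}[]$.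 The partial function $\chi^+$ satisfies $\chi^+(F^s(\mathit{rid},x),F^e(\mathit{rid},x))=[\,]$ for $F\in\{\lambda_{\mathsf{out_{ind}}},\lambda_{\mathsf{in_{ind}}},\lambda_{\mathsf{Fr_{ind}}}\}$; $\chi^+(e,e')=\chi(e,e')$ if $e$ is not of the form $F^s(\mathit{rid},x)$ and $e'$ is not of the form $F^e(\mathit{rid},x)$ for such $F$; and is undefined otherwise. *)

theory Defs
  imports "HOL-Library.Multiset"
begin

datatype sort = Msg | PubS | FreshS

datatype ('f, 'p, 'n) trm =
    Var sort nat
  | Pub 'p
  | Name 'n
  | App 'f "('f, 'p, 'n) trm list"

type_synonym ('f, 'p, 'n) subst = "sort \<Rightarrow> nat \<Rightarrow> ('f, 'p, 'n) trm"

primrec subst :: "('f, 'p, 'n) subst \<Rightarrow> ('f, 'p, 'n) trm \<Rightarrow> ('f, 'p, 'n) trm" where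
  "subst \<sigma> (Var s x) = \<sigma> s x"
| "subst \<sigma> (Pub c) = Pub c"
| "subst \<sigma> (Name a) = Name a"
| "subst \<sigma> (App f ts) = App f (map (subst \<sigma>) ts)"

inductive_set gterms :: "'f set \<Rightarrow> ('f \<Rightarrow> nat) \<Rightarrow> ('f, 'p, 'n) trm set"
  for Sig :: "'f set" and ar :: "'f \<Rightarrow> nat" where
  "Pub c \<in> gterms Sig ar"
| "Name a \<in> gterms Sig ar"
| "f \<in> Sig \<Longrightarrow> length ts = ar f \<Longrightarrow> (\<And>t. t \<in> set ts \<Longrightarrow> t \<in> gterms Sig ar)
    \<Longrightarrow> App f ts \<in> gterms Sig ar"

definition ground_subst :: "'f set \<Rightarrow> ('f \<Rightarrow> nat) \<Rightarrow> ('f, 'p, 'n) subst \<Rightarrow> bool" where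
  "ground_subst Sig ar \<sigma> \<longleftrightarrow>
     (\<forall>x. \<sigma> Msg x \<in> gterms Sig ar) \<and>
     (\<forall>x. \<sigma> PubS x \<in> range Pub) \<and>
     (\<forall>x. \<sigma> FreshS x \<in> range Name)"

datatype 'e env_sym = K | In | Out | Fr | Sym 'e

text \<open>\<open>Buf i F\<close> is the symbol of role \<open>i\<close>'s private buffered copy of the input or output
  symbol \<open>F\<close>; its first argument is the run identifier, which is itself a ground term.
  \<open>Ind\<close>, \<open>OutInd\<close> and \<open>InInd\<close> are the reserved symbols.\<close>

datatype ('e, 's) fsym =
    Env "'e env_sym"
  | State nat 's
  | Buf nat "'e env_sym"
  | Ind
  | OutInd
  | InInd

datatype (dead 'e, dead 's, 'm) fact = Fact (sym: "('e, 's) fsym") (args: "'m list")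

datatype ind_chan = OutIndC | InIndC | FrIndC

text \<open>\<open>Act a\<close> is an ordinary label, i.e. a multiset of (action) facts.  The other labels are
  the synchronization labels: \<open>SyncS F i rid m\<close> and \<open>SyncE F i rid m\<close> are the two sides
  (superscripts \<open>s\<close> and \<open>e\<close>) of the label \<open>\<lambda>\<close> for \<open>F, i, rid\<close> with arguments \<open>m\<close>, and
  \<open>IndS c rid x\<close>, \<open>IndE c rid x\<close> are those of the protocol-independent components.\<close>

datatype (dead 'e, dead 's, 'm) label =
    Act "('e, 's, 'm) fact multiset"
  | SyncS "'e env_sym" nat 'm "'m list"
  | SyncE "'e env_sym" nat 'm "'m list"
  | IndS ind_chan 'm 'm
  | IndE ind_chan 'm 'm

abbreviation empty_label :: "('e, 's, 'm) label" where
  "empty_label \<equiv> Act {#}"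

definition is_sync :: "('e, 's, 'm) label \<Rightarrow> bool" where
  "is_sync e \<longleftrightarrow> e \<notin> range Act"

datatype (dead 'e, dead 's, 'm) rule =
  Rule (lhs: "('e, 's, 'm) fact multiset")
       (lab: "('e, 's, 'm) label")
       (rhs: "('e, 's, 'm) fact multiset")

datatype ('st, 'l) lts = LTS (init: 'st) (step: "'st \<Rightarrow> 'l \<Rightarrow> 'st \<Rightarrow> bool")

inductive exec :: "('st, 'l) lts \<Rightarrow> 'l list \<Rightarrow> 'st \<Rightarrow> bool" for T where
  "exec T [] (init T)"
| "exec T ls s \<Longrightarrow> step T s l s' \<Longrightarrow> exec T (ls @ [l]) s'"

definition traces :: "('st, ('e, 's, 'm) label) lts \<Rightarrow> ('e, 's, 'm) label list set" where
  "traces T = {filter (\<lambda>l. l \<noteq> empty_label) ls | ls s. exec T ls s}"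

definition refines ::
  "('st, ('e, 's, 'm) label) lts \<Rightarrow> ('st', ('e, 's, 'm) label) lts \<Rightarrow> bool" (infix "\<preceq>" 50) where
  "X \<preceq> Y \<longleftrightarrow> traces X \<subseteq> traces Y"

definition interleave2 :: "('st, 'l) lts \<Rightarrow> ('st', 'l) lts \<Rightarrow> ('st \<times> 'st', 'l) lts"
    (infixr "|||" 55) where
  "X ||| Y = LTS (init X, init Y)
     (\<lambda>(x, y) l (x', y'). step X x l x' \<and> y' = y \<or> x' = x \<and> step Y y l y')"

definition interleave :: "'i set \<Rightarrow> ('i \<Rightarrow> ('st, 'l) lts) \<Rightarrow> ('i \<Rightarrow> 'st, 'l) lts" where
  "interleave I T = LTS (\<lambda>i. init (T i))
     (\<lambda>s l s'. \<exists>i\<in>I. \<exists>t. step (T i) (s i) l t \<and> s' = s(i := t))"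

text \<open>\<open>None\<close> as a component's contribution is \<open>skip\<close>; \<open>None\<close> as the value of the
  synchronization function is \<open>undefined\<close>.\<close>

fun move :: "('st, 'l) lts \<Rightarrow> 'st \<Rightarrow> 'l option \<Rightarrow> 'st \<Rightarrow> bool" where
  "move T s None s' \<longleftrightarrow> s' = s"
| "move T s (Some l) s' \<longleftrightarrow> step T s l s'"

definition sync ::
  "('l option \<Rightarrow> 'l option \<Rightarrow> 'l option) \<Rightarrow> ('st, 'l) lts \<Rightarrow> ('st', 'l) lts \<Rightarrow> ('st \<times> 'st', 'l) lts"
  where
  "sync f X Y = LTS (init X, init Y)
     (\<lambda>(x, y) l (x', y'). \<exists>d d'. f d d' = Some l \<and> move X x d x' \<and> move Y y d' y')"

definition chi ::
  "('e, 's, 'm) label option \<Rightarrow> ('e, 's, 'm) label option \<Rightarrow> ('e, 's, 'm) label option" where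
  "chi d d' = (case (d, d') of
      (Some e, Some e') \<Rightarrow>
        (if \<exists>F i rid m. e = SyncS F i rid m \<and> e' = SyncE F i rid m then Some empty_label else None)
    | (Some e, None) \<Rightarrow> (if is_sync e then None else Some e)
    | (None, Some e) \<Rightarrow> (if is_sync e then None else Some e)
    | (None, None) \<Rightarrow> None)"

definition chi_plus ::
  "('e, 's, 'm) label option \<Rightarrow> ('e, 's, 'm) label option \<Rightarrow> ('e, 's, 'm) label option" where
  "chi_plus d d' =
    (if \<exists>c rid x. d = Some (IndS c rid x) \<and> d' = Some (IndE c rid x) then Some empty_label
     else if (\<exists>c rid x. d = Some (IndS c rid x)) \<or> (\<exists>c rid x. d' = Some (IndE c rid x)) then None
     else chi d d')"

text \<open>\<open>role_rules i rid\<close> are the proper rules of run \<open>rid\<close> of role \<open>i\<close> (without the buffer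
  rules).  \<open>env_rules\<close> are the rules of the environment, apart from the generation of fresh
  names, which is not expressible as a rule and is built into \<open>env_lts\<close> below.\<close>

record ('f, 'p, 'n, 'e, 's) protocol =
  funs :: "'f set"
  arity :: "'f \<Rightarrow> nat"
  sym_arity :: "'e \<Rightarrow> nat"
  persistent :: "('e, 's) fsym \<Rightarrow> bool"
  roles :: nat
  runs :: "('f, 'p, 'n) trm set"
  inputs :: "'e env_sym set"
  outputs :: "'e env_sym set"
  role_rules :: "nat \<Rightarrow> ('f, 'p, 'n) trm \<Rightarrow> ('e, 's, ('f, 'p, 'n) trm) rule set"
  env_rules :: "('e, 's, ('f, 'p, 'n) trm) rule set"

fun env_arity :: "('f, 'p, 'n, 'e, 's) protocol \<Rightarrow> 'e env_sym \<Rightarrow> nat" where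
  "env_arity P (Sym e) = sym_arity P e"
| "env_arity P _ = 1"

abbreviation xvars :: "nat \<Rightarrow> ('f, 'p, 'n) trm list" where
  "xvars k \<equiv> map (Var Msg) [0..<k]"

abbreviation efact :: "'e env_sym \<Rightarrow> 'm list \<Rightarrow> ('e, 's, 'm) fact" where
  "efact F ts \<equiv> Fact (Env F) ts"

abbreviation ind :: "'m \<Rightarrow> 'm \<Rightarrow> ('e, 's, 'm) fact" where
  "ind rid t \<equiv> Fact Ind [rid, t]"

definition MD :: "('f, 'p, 'n, 'e, 's) protocol \<Rightarrow> ('e, 's, ('f, 'p, 'n) trm) rule set" where
  "MD P =
    {Rule {#efact Out [Var Msg 0]#} empty_label {#efact K [Var Msg 0]#},
     Rule {#efact K [Var Msg 0]#} (Act {#efact K [Var Msg 0]#}) {#efact In [Var Msg 0]#},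
     Rule {#} empty_label {#efact K [Var PubS 0]#},
     Rule {#efact Fr [Var FreshS 0]#} empty_label {#efact K [Var FreshS 0]#}} \<union>
    {Rule (mset (map (\<lambda>x. efact K [x]) (xvars (arity P f)))) empty_label
          {#efact K [App f (xvars (arity P f))]#} | f. f \<in> funs P}"

definition action_label :: "('e, 's, 'm) label \<Rightarrow> bool" where
  "action_label l \<longleftrightarrow> (\<exists>a. l = Act a \<and> sym ` set_mset a \<inter> {Ind, OutInd, InInd} = {})"

definition role_fact ::
  "('f, 'p, 'n, 'e, 's) protocol \<Rightarrow> nat \<Rightarrow> ('f, 'p, 'n) trm \<Rightarrow> ('e, 's, ('f, 'p, 'n) trm) fact \<Rightarrow> bool"
  where
  "role_fact P i rid \<phi> \<longleftrightarrow>
     (\<exists>s ts. \<phi> = Fact (State i s) ts) \<or>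
     (\<exists>F\<in>inputs P \<union> outputs P. \<exists>ts. \<phi> = Fact (Buf i F) (rid # ts))"

definition wf_protocol :: "('f, 'p, 'n, 'e, 's) protocol \<Rightarrow> bool" where
  "wf_protocol P \<longleftrightarrow>
     persistent P (Env K) \<and>
     \<not> persistent P (Env In) \<and> \<not> persistent P (Env Out) \<and> \<not> persistent P (Env Fr) \<and>
     persistent P Ind \<and> \<not> persistent P OutInd \<and> \<not> persistent P InInd \<and>
     runs P \<subseteq> gterms (funs P) (arity P) \<and>
     (\<forall>i\<in>{1..roles P}. \<forall>rid\<in>runs P. \<forall>\<rho>\<in>role_rules P i rid. action_label (lab \<rho>) \<and>
        (\<forall>\<phi>\<in>#lhs \<rho> + rhs \<rho>. role_fact P i rid \<phi>)) \<and>
     MD P \<subseteq> env_rules P \<and>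
     (\<forall>\<rho>\<in>env_rules P. action_label (lab \<rho>) \<and> (\<forall>\<phi>\<in>#lhs \<rho> + rhs \<rho>. sym \<phi> \<in> range Env))"

text \<open>Persistent facts of the left-hand side must be present but are compared as sets and are
  not removed.\<close>

inductive msr_step ::
  "('f, 'p, 'n, 'e, 's) protocol \<Rightarrow> ('e, 's, ('f, 'p, 'n) trm) rule set \<Rightarrow>
   ('e, 's, ('f, 'p, 'n) trm) fact multiset \<Rightarrow> ('e, 's, ('f, 'p, 'n) trm) label \<Rightarrow>
   ('e, 's, ('f, 'p, 'n) trm) fact multiset \<Rightarrow> bool"
  for P R where
  "\<rho> \<in> R \<Longrightarrow> ground_subst (funs P) (arity P) \<sigma> \<Longrightarrow>
   map_rule (subst \<sigma>) \<rho> = Rule l a r \<Longrightarrow>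
   L = {# \<phi> \<in># l. \<not> persistent P (sym \<phi>) #} \<Longrightarrow>
   L \<subseteq># S \<Longrightarrow> set_mset l \<subseteq> set_mset S \<Longrightarrow>
   msr_step P R S a (S - L + r)"

definition msr_lts ::
  "('f, 'p, 'n, 'e, 's) protocol \<Rightarrow> ('e, 's, ('f, 'p, 'n) trm) rule set \<Rightarrow>
   (('e, 's, ('f, 'p, 'n) trm) fact multiset, ('e, 's, ('f, 'p, 'n) trm) label) lts" where
  "msr_lts P R = LTS {#} (msr_step P R)"

text \<open>The state of an environment additionally records the fresh names generated so far.\<close>

inductive env_step ::
  "('f, 'p, 'n, 'e, 's) protocol \<Rightarrow> ('e, 's, ('f, 'p, 'n) trm) rule set \<Rightarrow>
   ('e, 's, ('f, 'p, 'n) trm) fact multiset \<times> 'n set \<Rightarrow> ('e, 's, ('f, 'p, 'n) trm) label \<Rightarrow>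
   ('e, 's, ('f, 'p, 'n) trm) fact multiset \<times> 'n set \<Rightarrow> bool"
  for P R where
  "msr_step P R S a S' \<Longrightarrow> env_step P R (S, U) a (S', U)"
| "a \<notin> U \<Longrightarrow> env_step P R (S, U) empty_label (add_mset (efact Fr [Name a]) S, insert a U)"

definition env_lts ::
  "('f, 'p, 'n, 'e, 's) protocol \<Rightarrow> ('e, 's, ('f, 'p, 'n) trm) rule set \<Rightarrow>
   (('e, 's, ('f, 'p, 'n) trm) fact multiset \<times> 'n set, ('e, 's, ('f, 'p, 'n) trm) label) lts" where
  "env_lts P R = LTS ({#}, {}) (env_step P R)"

definition role_msr ::
  "('f, 'p, 'n, 'e, 's) protocol \<Rightarrow> nat \<Rightarrow> ('f, 'p, 'n) trm \<Rightarrow> ('e, 's, ('f, 'p, 'n) trm) rule set" where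
  "role_msr P i rid = role_rules P i rid \<union>
    {Rule {#Fact (Buf i F) (rid # xvars (env_arity P F))#}
          (SyncS F i rid (xvars (env_arity P F))) {#} | F. F \<in> outputs P} \<union>
    {Rule {#} (SyncS F i rid (xvars (env_arity P F)))
          {#Fact (Buf i F) (rid # xvars (env_arity P F))#} | F. F \<in> inputs P}"

definition ind_msr ::
  "('f, 'p, 'n, 'e, 's) protocol \<Rightarrow> ('f, 'p, 'n) trm \<Rightarrow> ('e, 's, ('f, 'p, 'n) trm) rule set" where
  "ind_msr P rid =
    {Rule {#ind rid (Var Msg 0)#} (IndS OutIndC rid (Var Msg 0)) {#},
     Rule {#} (IndS InIndC rid (Var Msg 0)) {#ind rid (Var Msg 0)#},
     Rule {#} empty_label {#ind rid (Var PubS 0)#},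
     Rule {#} (IndS FrIndC rid (Var Msg 0)) {#ind rid (Var Msg 0)#}} \<union>
    {Rule (mset (map (ind rid) (xvars (arity P f)))) empty_label
          {#ind rid (App f (xvars (arity P f)))#} | f. f \<in> funs P}"

definition env_e_msr ::
  "('f, 'p, 'n, 'e, 's) protocol \<Rightarrow> ('e, 's, ('f, 'p, 'n) trm) rule set" where
  "env_e_msr P = env_rules P \<union>
    {Rule {#} (SyncE F i rid (xvars (env_arity P F))) {#efact F (xvars (env_arity P F))#}
       | F i rid. F \<in> outputs P \<and> i \<in> {1..roles P} \<and> rid \<in> runs P} \<union>
    {Rule {#efact F (xvars (env_arity P F))#} (SyncE F i rid (xvars (env_arity P F))) {#}
       | F i rid. F \<in> inputs P \<and> i \<in> {1..roles P} \<and> rid \<in> runs P}"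

definition env_e_plus_msr ::
  "('f, 'p, 'n, 'e, 's) protocol \<Rightarrow> ('e, 's, ('f, 'p, 'n) trm) rule set" where
  "env_e_plus_msr P = env_e_msr P \<union>
    (\<Union>rid\<in>runs P.
      {Rule {#} (IndE OutIndC rid (Var Msg 0)) {#Fact OutInd [Var Msg 0]#},
       Rule {#Fact InInd [Var Msg 0]#} (IndE InIndC rid (Var Msg 0)) {#},
       Rule {#efact Fr [Var FreshS 0]#} (IndE FrIndC rid (Var FreshS 0)) {#}})"

end

theory Submission imports Defs begin

text \<open>The reserved facts \<open>out_ind\<close> and \<open>in_ind\<close> occur in no rule of \<open>\<R>\<^sub>e\<^sub>n\<^sub>v\<close>, so a protocol-independent
  component can influence the rest of the system only by consuming \<open>Fr\<close> facts. The right-hand side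
  simulates the left-hand side by stuttering on every move of such a component: the role states
  agree, and the right environment contains all non-reserved facts of the left one, possibly with
  additional \<open>Fr\<close> facts. These do no harm because rules stay enabled in larger states.\<close>

text \<open>Induction on the execution of \<open>X\<close> builds one of \<open>Y\<close> with the
  same nonempty labels. A step of \<open>X\<close> that \<open>Y\<close> does not match has the
  empty label, which \<open>traces\<close> filters out.\<close>

lemma refinesI:
  assumes init: "R (init X) (init Y)"
    and step: "\<And>s t l s'. R s t \<Longrightarrow> step X s l s' \<Longrightarrow>
      l = empty_label \<and> R s' t \<or> (\<exists>t'. step Y t l t' \<and> R s' t')"
  shows "X \<preceq> Y"
proof -
  have "\<exists>ls' t. exec Y ls' t \<and> R s t \<and>
      filter (\<lambda>l. l \<noteq> empty_label) ls' = filter (\<lambda>l. l \<noteq> empty_label) ls"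
    if "exec X ls s" for ls s
    using that
  proof induction
    case 1
    show ?case
      using init exec.intros(1) by blast
  next
    case (2 ls s l s')
    then obtain ls' t where t: "exec Y ls' t" "R s t"
      "filter (\<lambda>l. l \<noteq> empty_label) ls' = filter (\<lambda>l. l \<noteq> empty_label) ls" by blast
    from step[OF t(2) 2(2)] show ?case
    proof (elim disjE conjE exE)
      assume "l = empty_label" "R s' t"
      then show ?thesis
        using t by (intro exI[of _ ls'] exI[of _ t]) simp
    next
      fix t' assume t': "step Y t l t'" "R s' t'"
      show ?thesis
        using t exec.intros(2)[OF t(1) t'(1)] t'(2)
        by (intro exI[of _ "ls' @ [l]"] exI[of _ t']) simp
    qed
  qed
  then have "filter (\<lambda>l. l \<noteq> empty_label) ls \<in> traces Y" if "exec X ls s" for ls s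
    using that unfolding traces_def by (metis (mono_tags, lifting) mem_Collect_eq)
  then show ?thesis
    by (auto simp: refines_def traces_def[of X])
qed

section \<open>Environment steps in larger states\<close>

lemma sym_map_fact [simp]: "sym (map_fact f \<phi>) = sym \<phi>"
  by (cases \<phi>) simp

text \<open>In the reachable states of a well-formed environment this removes exactly the reserved
  facts.\<close>

abbreviation env_part :: "('e, 's, 'm) fact multiset \<Rightarrow> ('e, 's, 'm) fact multiset" where
  "env_part S \<equiv> {#\<phi> \<in># S. sym \<phi> \<in> range Env#}"

text \<open>Substitution keeps fact symbols, so every instance of a left-hand side lies in
  \<open>env_part S\<close> and hence in \<open>T\<close>. The same instance fires in
  \<open>T\<close>, and the surplus of \<open>T\<close> survives.\<close>

lemma msr_step_mono:
  assumes step: "msr_step P R S a S'"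
    and R: "\<And>\<rho> \<phi>. \<rho> \<in> R \<Longrightarrow> \<phi> \<in># lhs \<rho> \<Longrightarrow> sym \<phi> \<in> range Env"
    and sub: "env_part S \<subseteq># T"
  shows "\<exists>T'. msr_step P R T a T' \<and> env_part S' \<subseteq># T'"
  using step
proof cases
  case (1 \<rho> \<sigma> l r L)
  have "l = image_mset (map_fact (subst \<sigma>)) (lhs \<rho>)"
    using 1(4) by (cases \<rho>) auto
  then have l: "sym \<phi> \<in> range Env" if "\<phi> \<in># l" for \<phi>
    using R[OF 1(2)] that by auto
  have L: "env_part L = L"
    using l 1(5) by (auto simp: filter_mset_eq_conv)
  have "L \<subseteq># env_part S"
    using multiset_filter_mono[OF 1(6)] L by metis
  then have "L \<subseteq># T"
    using sub by (rule subset_mset.order_trans)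
  moreover have "set_mset l \<subseteq> set_mset T"
    using 1(7) l set_mset_mono[OF sub] by fastforce
  ultimately have "msr_step P R T a (T - L + r)"
    using 1 by (intro msr_step.intros) auto
  moreover have "env_part S - L \<subseteq># T - L"
    using sub by (simp add: subseteq_mset_def diff_le_mono)
  \<comment> \<open>\<open>env_part\<close> distributes over difference and sum, fixes
    \<open>L\<close>, and can only shrink \<open>r\<close>.\<close>
  then have "env_part S' \<subseteq># T - L + r"
    using L 1(1) by (simp add: subset_mset.add_mono multiset_filter_subset)
  ultimately show ?thesis by blast
qed

text \<open>Name generation depends only on the record \<open>U\<close>, which both sides share, so
  surplus \<open>Fr\<close> facts cannot block it.\<close>

lemma env_step_mono:
  assumes "env_step P R (S, U) a (S', U')"
    and "\<And>\<rho> \<phi>. \<rho> \<in> R \<Longrightarrow> \<phi> \<in># lhs \<rho> \<Longrightarrow> sym \<phi> \<in> range Env"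
    and "env_part S \<subseteq># T"
  shows "\<exists>T'. env_step P R (T, U) a (T', U') \<and> env_part S' \<subseteq># T'"
  using assms(1)
proof cases
  case 1
  then obtain T' where "msr_step P R T a T'" "env_part S' \<subseteq># T'"
    using msr_step_mono[of P R S a S' T] assms(2,3) by blast
  with 1 show ?thesis
    by (auto intro: env_step.intros)
next
  case (2 x)
  then show ?thesis
    using assms(3) by (auto intro!: exI[of _ "add_mset (efact Fr [Name x]) T"] env_step.intros)
qed

lemma env_e_msr_lhs:
  assumes "wf_protocol P" "\<rho> \<in> env_e_msr P" "\<phi> \<in># lhs \<rho>"
  shows "sym \<phi> \<in> range Env"
  using assms by (auto simp: wf_protocol_def env_e_msr_def)

section \<open>Telling the added rules apart by their labels\<close>

lemma msr_step_Un:
  "msr_step P (R \<union> R') S a S' \<longleftrightarrow> msr_step P R S a S' \<or> msr_step P R' S a S'"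
  unfolding msr_step.simps Un_iff by blast

definition env_ind_msr ::
  "('f, 'p, 'n, 'e, 's) protocol \<Rightarrow> ('e, 's, ('f, 'p, 'n) trm) rule set" where
  "env_ind_msr P =
    (\<Union>rid\<in>runs P.
      {Rule {#} (IndE OutIndC rid (Var Msg 0)) {#Fact OutInd [Var Msg 0]#},
       Rule {#Fact InInd [Var Msg 0]#} (IndE InIndC rid (Var Msg 0)) {#},
       Rule {#efact Fr [Var FreshS 0]#} (IndE FrIndC rid (Var FreshS 0)) {#}})"

lemma env_e_plus_msr_eq: "env_e_plus_msr P = env_e_msr P \<union> env_ind_msr P"
  by (simp add: env_e_plus_msr_def env_ind_msr_def)

text \<open>The only fact these rules produce is \<open>OutInd\<close>, which
  \<open>env_part\<close> ignores; the only \<open>Env\<close> fact they touch is a consumed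
  \<open>Fr\<close>.\<close>

lemma env_ind_msr_step:
  assumes "msr_step P (env_ind_msr P) S a S'"
  shows "(\<exists>c rid x. a = IndE c rid x) \<and> env_part S' \<subseteq># env_part S"
proof -
  have drop: "env_part (S - M) \<subseteq># env_part S" for M
    by (intro multiset_filter_mono) simp
  show ?thesis
    using assms drop by cases (auto simp: env_ind_msr_def)
qed

text \<open>Substitution preserves label constructors, and the rules carry only \<open>Act\<close>
  and \<open>SyncE\<close> labels. With \<open>env_ind_msr_step\<close>, the label alone thus
  decides which group of rules fired.\<close>

lemma env_e_msr_label:
  assumes "wf_protocol P" "msr_step P (env_e_msr P) S a S'"
  shows "a \<noteq> IndE c rid x"
proof
  assume "a = IndE c rid x"
  with assms(2) obtain \<rho> \<sigma> where
    "\<rho> \<in> env_e_msr P" "map_label (subst \<sigma>) (lab \<rho>) = IndE c rid x"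
    by cases (auto dest!: arg_cong[where f = lab] simp: rule.map_sel(2))
  then show False
    using assms(1) by (auto simp: env_e_msr_def wf_protocol_def action_label_def)
qed

lemma role_msr_label:
  assumes "wf_protocol P" "i \<in> {1..roles P}" "rid \<in> runs P" "msr_step P (role_msr P i rid) S a S'"
  shows "a \<noteq> IndS c rid' x"
proof
  assume "a = IndS c rid' x"
  with assms(4) obtain \<rho> \<sigma> where
    "\<rho> \<in> role_msr P i rid" "map_label (subst \<sigma>) (lab \<rho>) = IndS c rid' x"
    by cases (auto dest!: arg_cong[where f = lab] simp: rule.map_sel(2))
  then show False
    using assms(1-3) by (fastforce simp: role_msr_def wf_protocol_def action_label_def)
qed

lemma ind_msr_label:
  assumes "msr_step P (ind_msr P rid) S a S'"
  shows "a = empty_label \<or> (\<exists>c rid x. a = IndS c rid x)"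
  using assms by cases (auto simp: ind_msr_def)

lemma env_step_plus_cases:
  assumes "wf_protocol P" "env_step P (env_e_plus_msr P) (S, U) a (S', U')"
  obtains (env) "env_step P (env_e_msr P) (S, U) a (S', U')" "\<And>c rid x. a \<noteq> IndE c rid x"
  | (ind) c rid x where "a = IndE c rid x" "env_part S' \<subseteq># env_part S" "U' = U"
  using assms(2)
proof cases
  case 1
  from 1(2) consider "msr_step P (env_e_msr P) S a S'" | "msr_step P (env_ind_msr P) S a S'"
    by (auto simp: env_e_plus_msr_eq msr_step_Un)
  then show ?thesis
  proof cases
    assume "msr_step P (env_e_msr P) S a S'"
    then show ?thesis
      using env_e_msr_label[OF assms(1)] 1(1) by (intro env) (simp_all add: env_step.intros(1))
  next
    assume "msr_step P (env_ind_msr P) S a S'"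
    from env_ind_msr_step[OF this] show ?thesis
      using ind 1(1) by blast
  qed
next
  case 2
  then show ?thesis
    by (intro env) (simp_all add: env_step.intros(2))
qed

text \<open>Separates communication with an independent component, which the right-hand system
  answers by not moving, from all moves on which \<open>chi_plus\<close> agrees with
  \<open>chi\<close>.\<close>

lemma chi_plus_cases:
  assumes "chi_plus d d' = Some l"
  obtains (ind) c rid x where "d = Some (IndS c rid x)" "d' = Some (IndE c rid x)" "l = empty_label"
  | (chi) "chi d d' = Some l" "\<And>c rid x. d \<noteq> Some (IndS c rid x)" "\<And>c rid x. d' \<noteq> Some (IndE c rid x)"
proof (cases "\<exists>c rid x. d = Some (IndS c rid x) \<and> d' = Some (IndE c rid x)")
  case True
  then have "l = empty_label"
    using assms unfolding chi_plus_def by simp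
  with True ind show ?thesis by blast
next
  case False
  then have "\<not> ((\<exists>c rid x. d = Some (IndS c rid x)) \<or> (\<exists>c rid x. d' = Some (IndE c rid x)))"
    using assms unfolding chi_plus_def by (metis option.distinct(1))
  moreover from this False have "chi d d' = Some l"
    using assms unfolding chi_plus_def by metis
  ultimately show ?thesis
    using chi by blast
qed

section \<open>Forgetting the independent components, and the simulation\<close>

abbreviation role_inds where
  "role_inds P \<equiv> interleave ({1..roles P} \<times> runs P)
     (\<lambda>(i, rid). msr_lts P (role_msr P i rid) ||| msr_lts P (ind_msr P rid))"

abbreviation role_only where
  "role_only P \<equiv> interleave ({1..roles P} \<times> runs P) (\<lambda>(i, rid). msr_lts P (role_msr P i rid))"

text \<open>\<open>fst \<circ> s\<close> forgets the states of the independent components. The empty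
  label may come from either kind of component, so the cases overlap in their labels.\<close>

lemma role_inds_step:
  assumes "wf_protocol P" "step (role_inds P) s a s'"
  obtains (role) "step (role_only P) (fst \<circ> s) a (fst \<circ> s')" "\<And>c rid x. a \<noteq> IndS c rid x"
  | (ind) "fst \<circ> s' = fst \<circ> s" "a = empty_label \<or> (\<exists>c rid x. a = IndS c rid x)"
proof -
  obtain i rid q r where i: "i \<in> {1..roles P}" "rid \<in> runs P" and s': "s' = s((i, rid) := (q, r))"
    and st: "step (msr_lts P (role_msr P i rid) ||| msr_lts P (ind_msr P rid)) (s (i, rid)) a (q, r)"
    using assms(2) by (auto simp: interleave_def)
  from st consider "msr_step P (role_msr P i rid) (fst (s (i, rid))) a q"
    | "q = fst (s (i, rid))" "msr_step P (ind_msr P rid) (snd (s (i, rid))) a r"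
    by (cases "s (i, rid)") (auto simp: interleave2_def msr_lts_def)
  then show thesis
  proof cases
    case 1
    have "fst \<circ> s' = (fst \<circ> s)((i, rid) := q)"
      using s' by auto
    then have "step (role_only P) (fst \<circ> s) a (fst \<circ> s')"
      using 1 i by (force simp: interleave_def msr_lts_def)
    then show thesis
      using role role_msr_label[OF assms(1) i 1] by blast
  next
    case 2
    have "fst \<circ> s' = fst \<circ> s"
      using 2(1) s' by auto
    then show thesis
      using ind ind_msr_label[OF 2(2)] by blast
  qed
qed

text \<open>The name records must be equal so that both sides can generate the same names. The facts
  need only be included: an \<open>Fr\<close> fact consumed by an independent component on the left
  remains on the right.\<close>

definition sim_rel where
  "sim_rel u v \<longleftrightarrow> fst v = fst \<circ> fst u \<and> snd (snd v) = snd (snd u) \<and>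
     env_part (fst (snd u)) \<subseteq># fst (snd v)"

theorem lemma1:
  fixes P :: "('f, 'p, 'n, 'e, 's) protocol"
  assumes "wf_protocol P"
  shows "sync chi_plus
           (interleave ({1..roles P} \<times> runs P)
              (\<lambda>(i, rid). msr_lts P (role_msr P i rid) ||| msr_lts P (ind_msr P rid)))
           (env_lts P (env_e_plus_msr P))
       \<preceq> sync chi
           (interleave ({1..roles P} \<times> runs P) (\<lambda>(i, rid). msr_lts P (role_msr P i rid)))
           (env_lts P (env_e_msr P))"
proof -
  show ?thesis
  proof (rule refinesI[where R = sim_rel])
    show "sim_rel (init (sync chi_plus (role_inds P) (env_lts P (env_e_plus_msr P))))
            (init (sync chi (role_only P) (env_lts P (env_e_msr P))))"
      by (auto simp: sim_rel_def sync_def interleave_def interleave2_def env_lts_def msr_lts_def)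
  next
    fix u v l u'
    assume "sim_rel u v" and st: "step (sync chi_plus (role_inds P) (env_lts P (env_e_plus_msr P))) u l u'"
    then obtain s S U T s' S' U' where u: "u = (s, (S, U))" and v: "v = (fst \<circ> s, (T, U))"
      and sub: "env_part S \<subseteq># T" and u': "u' = (s', (S', U'))"
      unfolding sim_rel_def by (cases u, cases v, cases u') auto
    from st obtain d d' where f: "chi_plus d d' = Some l"
      and d: "move (role_inds P) s d s'"
      and d': "move (env_lts P (env_e_plus_msr P)) (S, U) d' (S', U')"
      by (auto simp: sync_def u u')
    from f show "l = empty_label \<and> sim_rel u' v \<or>
        (\<exists>v'. step (sync chi (role_only P) (env_lts P (env_e_msr P))) v l v' \<and> sim_rel u' v')"
    proof (cases rule: chi_plus_cases)
      case (ind c rid x)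
      \<comment> \<open>Roles never emit \<open>IndS\<close>, so this move leaves their states
        alone, and the environment's \<open>env_part\<close> can only shrink: \<open>v\<close> still
        simulates \<open>u'\<close>.\<close>
      have "step (role_inds P) s (IndS c rid x) s'"
        using d ind(1) by simp
      then have "fst \<circ> s' = fst \<circ> s"
        by (rule role_inds_step[OF assms]) auto
      moreover have "env_part S' \<subseteq># env_part S \<and> U' = U"
        using d' ind(2) by (auto simp: env_lts_def elim: env_step_plus_cases[OF assms])
      ultimately show ?thesis
        using ind(3) sub by (auto simp: sim_rel_def u' v intro: subset_mset.order_trans)
    next
      case chi
      have "\<exists>T'. move (env_lts P (env_e_msr P)) (T, U) d' (T', U') \<and> env_part S' \<subseteq># T'"
      proof (cases d')
        case None
        then show ?thesis
          using d' sub by auto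
      next
        case (Some e')
        then have "env_step P (env_e_msr P) (S, U) e' (S', U')"
          using d' chi(3) by (auto simp: env_lts_def elim: env_step_plus_cases[OF assms])
        then show ?thesis
          using env_step_mono[OF _ env_e_msr_lhs[OF assms] sub] Some by (auto simp: env_lts_def)
      qed
      then obtain T' where T': "move (env_lts P (env_e_msr P)) (T, U) d' (T', U')"
        and sub': "env_part S' \<subseteq># T'" by blast
      \<comment> \<open>The second alternative is a silent move of an independent component: it adds
        a public constant or applies a function symbol.\<close>
      have "move (role_only P) (fst \<circ> s) d (fst \<circ> s') \<or> fst \<circ> s' = fst \<circ> s \<and> d = Some empty_label"
      proof (cases d)
        case None
        with d show ?thesis by simp
      next
        case (Some e)
        with d have "step (role_inds P) s e s'"
          by simp
        then show ?thesis
          using chi(2) Some by (elim role_inds_step[OF assms]) auto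
      qed
      then show ?thesis
      proof (elim disjE conjE)
        assume "move (role_only P) (fst \<circ> s) d (fst \<circ> s')"
        then have "step (sync chi (role_only P) (env_lts P (env_e_msr P))) v l (fst \<circ> s', (T', U'))"
          using chi(1) T' by (auto simp: sync_def v)
        then show ?thesis
          using sub' by (auto simp: sim_rel_def u')
      next
        assume eq: "fst \<circ> s' = fst \<circ> s" and d_eq: "d = Some empty_label"
        \<comment> \<open>\<open>chi\<close> pairs the empty label only with \<open>skip\<close>, so
          the environment stands still and the right-hand system stutters.\<close>
        have "d' = None" "l = empty_label"
          using chi(1) d_eq by (auto simp: chi_def split: option.splits if_splits)
        then show ?thesis
          using d' eq sub by (auto simp: sim_rel_def u' v)
      qed
    qed
  qed
qed

end
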